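(* Let $\mathbf{u}\in Z\subset X^{\ast}$ be the unique solution of the abstract PDE $\mathcal{D}(\mathbf{u})=\mathbf{f}$, and assume the stability hypothesis: for all $\mathbf{v},\mathbf{w}\in Z$, $$\|\mathbf{v}-\mathbf{w}\|_{X}\le C_{pde}\big(\|\mathbf{v}\|_Z,\|\mathbf{w}\|_Z\big)\,\|\mathcal{D}(\mathbf{v})-\mathcal{D}(\mathbf{w})\|_{Y}.$$ Let $\mathbf{u}^{\ast}=\mathbf{u}_{\theta^{\ast}}\in Z\subset X^{\ast}$ be the PINN generated by the PINN algorithm (see context), based on the training set $\mathcal{S}=\{y_n\}_{n=1}^N$ of quadrature points with weights $w_n$. Assume further that the residual $\mathcal{R}_{\theta^{\ast}}=\mathcal{D}(\mathbf{u}^{\ast})-\mathbf{f}$ belongs to $Z^{\ast}$ and that the quadrature error satisfies the bound stated in the context, applied to the integrand $|\mathcal{R}_{\theta^{\ast}}|^p$, i.e. $$\Big|\int_{\mathbb{D}}|\mathcal{R}_{\theta^{\ast}}(y)|^p\,dy-\sum_{n=1}^N w_n|\mathcal{R}_{\theta^{\ast}}(y_n)|^p\Big|\le C_{quad}N^{-\alpha}.$$ Then the generalization error $\mathcal{E}_G=\|\mathbf{u}-\mathbf{u}^{\ast}\|_X$ and the training error $\mathcal{E}_T=\big(\sum_{n=1}^N w_n|\mathcal{R}_{\theta^{\ast}}(y_n)|^p\big)^{1/p}$ satisfy $$\mathcal{E}_G\le C_{pde}\,\mathcal{E}_T+C_{pde}\,C_{quad}^{\frac1p}\,N^{-\frac{\alpha}{p}},$$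 with $C_{pde}=C_{pde}(\|\mathbf{u}\|_Z,\|\mathbf{u}^{\ast}\|_Z)$ the stability constant and $C_{quad}=C_{quad}\big(\big\||\mathcal{R}_{\theta^{\ast}}|^p\big\|_{Z^{\ast}},\bar d\big)$ the quadrature constant. (These constants depend on $\mathbf{u}^{\ast}$, which in turn can depend on $N$.)
   Context: Spaces: $\mathbb{D}\subset\mathbb{R}^{\bar d}$, $\bar d\ge1$; $Y=L^p(\mathbb{D};\mathbb{R}^m)$ and $X=W^{s,q}(\mathbb{D};\mathbb{R}^m)$ with $m\ge1$, $1\le p,q<\infty$, $s\ge0$. $X^{\ast}\subset X$ and $Y^{\ast}\subset Y$ are closed subspaces with norms $\|\cdot\|_{X^\ast}$, $\|\cdot\|_{Y^\ast}$ (they are not dual spaces), $Z\subset X^{\ast}$ is a closed subspace with norm $\|\cdot\|_Z$, and $Z^{\ast}\subset Y^{\ast}$ is a space of integrands with norm $\|\cdot\|_{Z^{\ast}}$. PDE: $\mathcal{D}:X^{\ast}\to Y^{\ast}$ is a (possibly nonlinear) operator and $\mathbf{f}\in Y^{\ast}$, with $\|\mathcal{D}(\mathbf{v})\|_{Y^\ast}<\infty$ whenever $\|\mathbf{v}\|_{X^\ast}<\infty$, and $\|\mathbf{f}\|_{Y^\ast}<\infty$. For every $\mathbf{f}\in Y^{\ast}$ there is a unique $\mathbf{u}\in X^{\ast}$ with $\mathcal{D}(\mathbf{u})=\mathbf{f}$. Initial and boundary conditions are implicitly included in $\mathcal{D}$. Quadrature: points $y_1,\dots,y_N\in\mathbb{D}$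 and weights $w_i>0$; for an integrand $g$, the integral $\overline g=\int_{\mathbb{D}}g(y)\,dy$ is approximated by $\overline g_N=\sum_{i=1}^N w_i g(y_i)$, with error bound $|\overline g-\overline g_N|\le C_{quad}(\|g\|_{Z^{\ast}},\bar d)\,N^{-\alpha}$ for some $\alpha>0$. Neural networks: $\mathbf{u}_\theta=C_K\circ\sigma\circ C_{K-1}\circ\cdots\circ\sigma\circ C_1$, with affine maps $C_kz=W_kz+b_k$, a scalar activation function $\sigma$ applied componentwise, and parameters $\theta=\{W_k,b_k\}\in\Theta\subset\mathbb{R}^M$; it is assumed that $\mathbf{u}_\theta\in X^{\ast}$ with $\|\mathbf{u}_\theta\|_{X^{\ast}}<\infty$ for every $\theta\in\Theta$. Residual: $\mathcal{R}_\theta=\mathcal{D}(\mathbf{u}_\theta)-\mathbf{f}$. PINN algorithm: choose as training set the quadrature points $\{y_n\}_{n=1}^N$, and return $\theta^{\ast}\in\Theta$, an (approximate, local) minimizer of $\theta\mapsto J(\theta)+\lambda_{reg}J_{reg}(\theta)$, where $J(\theta)=\sum_{n=1}^Nw_n|\mathcal{R}_\theta(y_n)|^p$, $J_{reg}:\Theta\to\mathbb{R}$ is a regularization term and $\lambda_{reg}\ge0$. The PINN is $\mathbf{u}^{\ast}=\mathbf{u}_{\theta^{\ast}}$. No quantitative property of the minimization is assumed. *)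

theory Defs
  imports "HOL-Analysis.Analysis"
begin

text \<open>
  Function spaces over an open set \<open>D\<close> are sets of functions on the whole space of which only the
  values on \<open>D\<close> matter.  Functions are not identified modulo null sets, because the quadrature
  needs point values; instead, equality in a function space is equality almost everywhere
  with respect to \<open>lebesgue_on D\<close>.
\<close>

section \<open>Normed spaces of functions modulo null sets\<close>

definition fun_subspace :: "('a \<Rightarrow> 'b::real_vector) set \<Rightarrow> bool" where
  "fun_subspace V \<longleftrightarrow>
     (\<lambda>x. 0) \<in> V \<and>
     (\<forall>v\<in>V. \<forall>w\<in>V. (\<lambda>x. v x + w x) \<in> V) \<and>
     (\<forall>c. \<forall>v\<in>V. (\<lambda>x. c *\<^sub>R v x) \<in> V)"

text \<open>A norm that may take the value \<open>\<infinity>\<close>, definite modulo null sets.\<close>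

definition ext_norm_on ::
  "'a measure \<Rightarrow> ('a \<Rightarrow> 'b::real_vector) set \<Rightarrow> (('a \<Rightarrow> 'b) \<Rightarrow> ennreal) \<Rightarrow> bool" where
  "ext_norm_on M V N \<longleftrightarrow>
     (\<forall>v\<in>V. N v = 0 \<longleftrightarrow> (AE x in M. v x = 0)) \<and>
     (\<forall>c. \<forall>v\<in>V. N (\<lambda>x. c *\<^sub>R v x) = ennreal \<bar>c\<bar> * N v) \<and>
     (\<forall>v\<in>V. \<forall>w\<in>V. N (\<lambda>x. v x + w x) \<le> N v + N w)"

definition norm_on ::
  "'a measure \<Rightarrow> ('a \<Rightarrow> 'b::real_vector) set \<Rightarrow> (('a \<Rightarrow> 'b) \<Rightarrow> real) \<Rightarrow> bool" where
  "norm_on M V N \<longleftrightarrow> (\<forall>v\<in>V. 0 \<le> N v) \<and> ext_norm_on M V (\<lambda>v. ennreal (N v))"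

text \<open>
  \<open>W\<close> is a subspace of \<open>V\<close> that is closed for the norm \<open>N\<close> of \<open>V\<close>.  Such a \<open>W\<close> is automatically
  closed under changing a function on a null set (use constant sequences).
\<close>

definition closed_subspace_of ::
  "('a \<Rightarrow> 'b::real_vector) set \<Rightarrow> ('a \<Rightarrow> 'b) set \<Rightarrow> (('a \<Rightarrow> 'b) \<Rightarrow> 'n::{zero,topological_space}) \<Rightarrow> bool"
  where
  "closed_subspace_of W V N \<longleftrightarrow>
     W \<subseteq> V \<and> fun_subspace W \<and>
     (\<forall>w v. (\<forall>n::nat. w n \<in> W) \<and> v \<in> V \<and> (\<lambda>n. N (\<lambda>x. w n x - v x)) \<longlonglongrightarrow> 0 \<longrightarrow> v \<in> W)"

section \<open>Lebesgue spaces\<close>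

definition Lp_space :: "real \<Rightarrow> 'a measure \<Rightarrow> ('a \<Rightarrow> 'b::real_normed_vector) set" where
  "Lp_space p M = {f \<in> borel_measurable M. integrable M (\<lambda>x. norm (f x) powr p)}"

definition Lp_norm :: "real \<Rightarrow> 'a measure \<Rightarrow> ('a \<Rightarrow> 'b::real_normed_vector) \<Rightarrow> real" where
  "Lp_norm p M f = (LINT x|M. norm (f x) powr p) powr (1 / p)"

section \<open>Sobolev(-Slobodeckij) spaces\<close>

definition partial_deriv :: "'d \<Rightarrow> (real^'d \<Rightarrow> real) \<Rightarrow> real^'d \<Rightarrow> real" where
  "partial_deriv i \<phi> x = frechet_derivative \<phi> (at x) (axis i 1)"

primrec partial_derivs :: "'d list \<Rightarrow> (real^'d \<Rightarrow> real) \<Rightarrow> real^'d \<Rightarrow> real" where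
  "partial_derivs [] \<phi> = \<phi>"
| "partial_derivs (i # is) \<phi> = partial_deriv i (partial_derivs is \<phi>)"

definition test_function :: "(real^'d) set \<Rightarrow> (real^'d \<Rightarrow> real) \<Rightarrow> bool" where
  "test_function D \<phi> \<longleftrightarrow>
     (\<forall>is x. partial_derivs is \<phi> differentiable (at x)) \<and>
     compact (closure {x. \<phi> x \<noteq> 0}) \<and> closure {x. \<phi> x \<noteq> 0} \<subseteq> D"

definition locally_integrable :: "(real^'d) set \<Rightarrow> (real^'d \<Rightarrow> real^'m) \<Rightarrow> bool" where
  "locally_integrable D f \<longleftrightarrow> (\<forall>K. compact K \<and> K \<subseteq> D \<longrightarrow> set_integrable lebesgue K f)"

text \<open>
  Multi-indices are functions \<open>a :: 'd \<Rightarrow> nat\<close>.  The partial derivatives making up the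
  derivative of multi-index \<open>a\<close> may be taken in any order \<open>is\<close>, since test functions are smooth.
\<close>

definition multi_order :: "('d::finite \<Rightarrow> nat) \<Rightarrow> nat" where
  "multi_order a = (\<Sum>i\<in>UNIV. a i)"

definition has_weak_deriv ::
  "(real^'d) set \<Rightarrow> ('d \<Rightarrow> nat) \<Rightarrow> (real^'d \<Rightarrow> real^'m) \<Rightarrow> (real^'d \<Rightarrow> real^'m) \<Rightarrow> bool" where
  "has_weak_deriv D a f g \<longleftrightarrow>
     locally_integrable D f \<and> locally_integrable D g \<and>
     (\<forall>\<phi> is. test_function D \<phi> \<and> (\<forall>i. count_list is i = a i) \<longrightarrow>
        (LINT x|lebesgue_on D. partial_derivs is \<phi> x *\<^sub>R f x) =
        (-1) ^ multi_order a *\<^sub>R (LINT x|lebesgue_on D. \<phi> x *\<^sub>R g x))"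

text \<open>On open \<open>D\<close>, the choice is unique up to a null set.\<close>

definition weak_deriv ::
  "(real^'d) set \<Rightarrow> ('d \<Rightarrow> nat) \<Rightarrow> (real^'d \<Rightarrow> real^'m) \<Rightarrow> real^'d \<Rightarrow> real^'m" where
  "weak_deriv D a f = (SOME g. has_weak_deriv D a f g)"

text \<open>The integrand of the Gagliardo seminorm of order \<open>r\<close> (on the diagonal it is \<open>0 / 0 = 0\<close>).\<close>

definition gagliardo :: "real \<Rightarrow> real \<Rightarrow> (real^'d \<Rightarrow> real^'m) \<Rightarrow> (real^'d) \<times> (real^'d) \<Rightarrow> real" where
  "gagliardo r q g = (\<lambda>(x, y). norm (g x - g y) powr q / dist x y powr (real CARD('d) + r * q))"

text \<open>
  For \<open>s = k + r\<close> with \<open>k = \<lfloor>s\<rfloor>\<close> and \<open>0 < r < 1\<close>, the weak derivatives of order \<open>k\<close> must have finite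
  Gagliardo seminorm of order \<open>r\<close>; for integer \<open>s\<close> the space is the classical one.
\<close>

definition sobolev_space :: "(real^'d) set \<Rightarrow> real \<Rightarrow> real \<Rightarrow> (real^'d \<Rightarrow> real^'m) set" where
  "sobolev_space D s q =
     {f \<in> Lp_space q (lebesgue_on D).
        (\<forall>a. multi_order a \<le> nat \<lfloor>s\<rfloor> \<longrightarrow>
           (\<exists>g \<in> Lp_space q (lebesgue_on D). has_weak_deriv D a f g)) \<and>
        (0 < frac s \<longrightarrow>
           (\<forall>a. multi_order a = nat \<lfloor>s\<rfloor> \<longrightarrow>
              integrable (lebesgue_on D \<Otimes>\<^sub>M lebesgue_on D) (gagliardo (frac s) q (weak_deriv D a f))))}"

definition sobolev_norm :: "(real^'d) set \<Rightarrow> real \<Rightarrow> real \<Rightarrow> (real^'d \<Rightarrow> real^'m) \<Rightarrow> real" where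
  "sobolev_norm D s q f =
     ((\<Sum>a | multi_order a \<le> nat \<lfloor>s\<rfloor>. LINT x|lebesgue_on D. norm (weak_deriv D a f x) powr q) +
      (if 0 < frac s
       then (\<Sum>a | multi_order a = nat \<lfloor>s\<rfloor>.
               LINT z|(lebesgue_on D \<Otimes>\<^sub>M lebesgue_on D). gagliardo (frac s) q (weak_deriv D a f) z)
       else 0)) powr (1 / q)"

section \<open>Neural networks\<close>

text \<open>
  The layer widths are \<open>n 0, \<dots>, n K\<close> and the neurons of a layer are numbered from 0.  A parameter
  \<open>(W, b)\<close> consists of the weights \<open>W k i j\<close> (for \<open>i < n k\<close>, \<open>j < n (k - 1)\<close>) and the biases
  \<open>b k i\<close> of the layers \<open>k = 1, \<dots>, K\<close>.  With all other entries 0, these form a copy of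
  \<open>M\<close>-dimensional space, \<open>M\<close> being the sum of the \<open>(n (k - 1) + 1) * n k\<close>.
\<close>

type_synonym params = "(nat \<Rightarrow> nat \<Rightarrow> nat \<Rightarrow> real) \<times> (nat \<Rightarrow> nat \<Rightarrow> real)"

definition param_space :: "nat \<Rightarrow> (nat \<Rightarrow> nat) \<Rightarrow> params set" where
  "param_space K n =
     {(W, b). (\<forall>k i j. \<not> (1 \<le> k \<and> k \<le> K \<and> i < n k \<and> j < n (k - 1)) \<longrightarrow> W k i j = 0) \<and>
              (\<forall>k i. \<not> (1 \<le> k \<and> k \<le> K \<and> i < n k) \<longrightarrow> b k i = 0)}"

definition affine_layer :: "(nat \<Rightarrow> nat) \<Rightarrow> params \<Rightarrow> nat \<Rightarrow> (nat \<Rightarrow> real) \<Rightarrow> nat \<Rightarrow> real" where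
  "affine_layer n \<theta> k z = (\<lambda>i. (\<Sum>j<n (k - 1). fst \<theta> k i j * z j) + snd \<theta> k i)"

text \<open>
  \<open>nn_layers n sg \<theta> z k\<close> is \<open>C\<^sub>k \<circ> sg \<circ> C\<^sub>k\<^sub>-\<^sub>1 \<circ> \<dots> \<circ> sg \<circ> C\<^sub>1\<close> applied to \<open>z\<close>: the activation \<open>sg\<close> acts
  between the affine maps, neither on the input nor after the last one.
\<close>

fun nn_layers :: "(nat \<Rightarrow> nat) \<Rightarrow> (real \<Rightarrow> real) \<Rightarrow> params \<Rightarrow> (nat \<Rightarrow> real) \<Rightarrow> nat \<Rightarrow> nat \<Rightarrow> real" where
  "nn_layers n sg \<theta> z 0 = z"
| "nn_layers n sg \<theta> z (Suc 0) = affine_layer n \<theta> 1 z"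
| "nn_layers n sg \<theta> z (Suc (Suc k)) =
     affine_layer n \<theta> (Suc (Suc k)) (\<lambda>j. sg (nn_layers n sg \<theta> z (Suc k) j))"

text \<open>
  Coordinates of the input and output space are numbered by the bijections \<open>to_nat_on UNIV\<close> from
  \<open>'d\<close> and \<open>'m\<close> to the numbers below \<open>CARD('d)\<close> and \<open>CARD('m)\<close>; the network is meant to have
  \<open>n 0 = CARD('d)\<close> and \<open>n K = CARD('m)\<close>.
\<close>

definition neural_net ::
  "nat \<Rightarrow> (nat \<Rightarrow> nat) \<Rightarrow> (real \<Rightarrow> real) \<Rightarrow> params \<Rightarrow> real^'d \<Rightarrow> real^'m" where
  "neural_net K n sg \<theta> x =
     (\<chi> i. nn_layers n sg \<theta> (\<lambda>j. x $ from_nat_into (UNIV :: 'd set) j) K (to_nat_on (UNIV :: 'm set) i))"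

section \<open>The PINN algorithm\<close>

definition residual ::
  "((real^'d \<Rightarrow> real^'m) \<Rightarrow> real^'d \<Rightarrow> real^'m) \<Rightarrow> (real^'d \<Rightarrow> real^'m) \<Rightarrow>
   (real^'d \<Rightarrow> real^'m) \<Rightarrow> real^'d \<Rightarrow> real^'m" where
  "residual \<D> f v = (\<lambda>y. \<D> v y - f y)"

definition quadrature :: "nat \<Rightarrow> (nat \<Rightarrow> real^'d) \<Rightarrow> (nat \<Rightarrow> real) \<Rightarrow> (real^'d \<Rightarrow> real) \<Rightarrow> real" where
  "quadrature N y w g = (\<Sum>i=1..N. w i * g (y i))"

text \<open>
  A local minimizer over \<open>\<Theta>\<close> up to some tolerance \<open>e\<close>, neither the tolerance nor the size \<open>d\<close> of the
  neighbourhood being prescribed.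
\<close>

definition approx_local_minimizer :: "(params \<Rightarrow> real) \<Rightarrow> params set \<Rightarrow> params \<Rightarrow> bool" where
  "approx_local_minimizer L \<Theta> \<theta>s \<longleftrightarrow>
     \<theta>s \<in> \<Theta> \<and>
     (\<exists>e\<ge>0. \<exists>d>0. \<forall>\<theta>\<in>\<Theta>.
        (\<forall>k i j. \<bar>fst \<theta> k i j - fst \<theta>s k i j\<bar> < d) \<and> (\<forall>k i. \<bar>snd \<theta> k i - snd \<theta>s k i\<bar> < d) \<longrightarrow>
        L \<theta>s \<le> L \<theta> + e)"

end

theory Submission
  imports Defs
begin

text \<open>
  Since \<open>\<D> u = f\<close> almost everywhere, the stability estimate bounds the generalization error by
  \<open>C\<^sub>p\<^sub>d\<^sub>e\<close> times the \<open>L\<^sup>p\<close> norm of the residual.  The \<open>p\<close>-th power of that norm is the exact integral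
  of which the \<open>p\<close>-th power of the training error is the quadrature, so it exceeds the latter by
  at most the quadrature error; subadditivity of \<open>t \<mapsto> t\<^bsup>1/p\<^esup>\<close> separates the two terms.
\<close>

text \<open>Dividing by \<open>(a + b) powr r\<close> reduces the claim to fractions
  \<open>t\<close> of the total that sum to 1. On the unit interval \<open>t \<le> t powr r\<close>,
  since lowering the exponent from 1 to \<open>r\<close> can only increase the power.\<close>

lemma powr_add_le:
  fixes a b r :: real
  assumes "0 \<le> a" "0 \<le> b" "0 \<le> r" "r \<le> 1"
  shows "(a + b) powr r \<le> a powr r + b powr r"
proof (cases "a + b = 0")
  case True
  then show ?thesis by simp
next
  case False
  with assms have pos: "0 < a + b" by linarith
  have frac_le: "t \<le> t powr r" if "0 \<le> t" "t \<le> 1" for t :: real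
    using powr_mono'[OF \<open>r \<le> 1\<close> that] that by simp
  have "1 = a / (a + b) + b / (a + b)"
    using pos by (simp flip: add_divide_distrib)
  also have "\<dots> \<le> (a / (a + b)) powr r + (b / (a + b)) powr r"
    using assms pos by (intro add_mono frac_le) auto
  also have "\<dots> = (a powr r + b powr r) / (a + b) powr r"
    using assms by (simp add: powr_divide add_divide_distrib)
  finally show ?thesis
    using pos by (simp add: field_simps)
qed

lemma Lp_norm_cong_AE:
  assumes "g \<in> borel_measurable M" "h \<in> borel_measurable M"
    and "AE x in M. norm (g x) = norm (h x)"
  shows "Lp_norm p M g = Lp_norm p M h"
proof -
  have "(LINT x|M. norm (g x) powr p) = (LINT x|M. norm (h x) powr p)"
    by (rule integral_cong_AE) (use assms in auto)
  then show ?thesis by (simp add: Lp_norm_def)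
qed

lemma closed_subspace_of_subset: "closed_subspace_of W V N \<Longrightarrow> W \<subseteq> V"
  by (simp add: closed_subspace_of_def)

lemma quadrature_nonneg:
  assumes "\<And>i. i \<in> {1..N} \<Longrightarrow> 0 \<le> w i" "\<And>z. 0 \<le> g z"
  shows "0 \<le> quadrature N y w g"
  unfolding quadrature_def using assms by (intro sum_nonneg mult_nonneg_nonneg)

text \<open>The integral is at most \<open>Q\<close> plus the error bound; taking the
  \<open>p\<close>-th root is monotone, and subadditive by \<open>powr_add_le\<close> because
  \<open>1 / p \<le> 1\<close>.\<close>

lemma Lp_norm_le_quadrature:
  assumes "1 \<le> p" "1 \<le> N" "0 \<le> Q"
    and err: "\<bar>(LINT z|M. norm (g z) powr p) - Q\<bar> \<le> C * real N powr (- \<alpha>)"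
  shows "Lp_norm p M g \<le> Q powr (1 / p) + C powr (1 / p) * real N powr (- (\<alpha> / p))"
proof -
  \<comment> \<open>The sign of \<open>C\<close> comes from the error estimate itself: the bound
    dominates an absolute value, and its factor \<open>real N powr (- \<alpha>)\<close> is positive
    because \<open>N\<close> is.\<close>
  have "0 \<le> C * real N powr (- \<alpha>)"
    using err by linarith
  then have C: "0 \<le> C"
    using \<open>1 \<le> N\<close> by (simp add: zero_le_mult_iff)
  have "Lp_norm p M g \<le> (Q + C * real N powr (- \<alpha>)) powr (1 / p)"
    unfolding Lp_norm_def using assms by (intro powr_mono2) auto
  also have "\<dots> \<le> Q powr (1 / p) + (C * real N powr (- \<alpha>)) powr (1 / p)"
    using assms C by (intro powr_add_le) auto
  also have "(C * real N powr (- \<alpha>)) powr (1 / p) = C powr (1 / p) * real N powr (- (\<alpha> / p))"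
    using C by (simp add: powr_mult powr_powr)
  finally show ?thesis .
qed

theorem theorem2p6:
  fixes D :: "(real^'d) set"
    and p q s :: real
    and Xs Z Ys Zs :: "(real^'d \<Rightarrow> real^'m) set"
    and Zs1 :: "(real^'d \<Rightarrow> real) set"
    and nXs nYs :: "(real^'d \<Rightarrow> real^'m) \<Rightarrow> ennreal"
    and nZ nZs :: "(real^'d \<Rightarrow> real^'m) \<Rightarrow> real"
    and nZs1 :: "(real^'d \<Rightarrow> real) \<Rightarrow> real"
    and \<D> :: "(real^'d \<Rightarrow> real^'m) \<Rightarrow> real^'d \<Rightarrow> real^'m"
    and f u ustar :: "real^'d \<Rightarrow> real^'m"
    and Cpde :: "real \<Rightarrow> real \<Rightarrow> real"
    and Cquad :: "real \<Rightarrow> nat \<Rightarrow> real"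
    and \<alpha> :: real
    and N :: nat and y :: "nat \<Rightarrow> real^'d" and w :: "nat \<Rightarrow> real"
    and K :: nat and n :: "nat \<Rightarrow> nat" and sg :: "real \<Rightarrow> real"
    and \<Theta> :: "params set" and \<theta>s :: params
    and lam :: real and Jreg :: "params \<Rightarrow> real"
    \<comment> \<open>spaces\<close>
  assumes "open D" and "1 \<le> p" and "1 \<le> q" and "0 \<le> s"
    and "closed_subspace_of Xs (sobolev_space D s q) (sobolev_norm D s q)"
    and "ext_norm_on (lebesgue_on D) Xs nXs"
    and "closed_subspace_of Ys (Lp_space p (lebesgue_on D)) (Lp_norm p (lebesgue_on D))"
    and "ext_norm_on (lebesgue_on D) Ys nYs"
    and "closed_subspace_of Z Xs nXs" and "norm_on (lebesgue_on D) Z nZ"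
    and "Zs \<subseteq> Ys" and "fun_subspace Zs" and "norm_on (lebesgue_on D) Zs nZs"
    \<comment> \<open>the scalar counterpart of \<open>Zs\<close>, needed for the norm of the scalar integrand below\<close>
    and "fun_subspace Zs1" and "norm_on (lebesgue_on D) Zs1 nZs1"
    \<comment> \<open>abstract PDE; operator and solvability are understood modulo null sets\<close>
    and "\<And>v. v \<in> Xs \<Longrightarrow> \<D> v \<in> Ys"
    and "\<And>v v'. v \<in> Xs \<Longrightarrow> v' \<in> Xs \<Longrightarrow> (AE x in lebesgue_on D. v x = v' x) \<Longrightarrow>
           (AE x in lebesgue_on D. \<D> v x = \<D> v' x)"
    and "\<And>v. v \<in> Xs \<Longrightarrow> nXs v < \<infinity> \<Longrightarrow> nYs (\<D> v) < \<infinity>"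
    and "\<And>g. g \<in> Ys \<Longrightarrow>
           \<exists>v\<in>Xs. (AE x in lebesgue_on D. \<D> v x = g x) \<and>
             (\<forall>v'\<in>Xs. (AE x in lebesgue_on D. \<D> v' x = g x) \<longrightarrow> (AE x in lebesgue_on D. v' x = v x))"
    and "f \<in> Ys" and "nYs f < \<infinity>"
    and "u \<in> Z" and "AE x in lebesgue_on D. \<D> u x = f x"
    \<comment> \<open>stability\<close>
    and "\<And>a b. 0 \<le> a \<Longrightarrow> 0 \<le> b \<Longrightarrow> 0 \<le> Cpde a b"
    and "\<And>v v'. v \<in> Z \<Longrightarrow> v' \<in> Z \<Longrightarrow>
           sobolev_norm D s q (\<lambda>x. v x - v' x)
             \<le> Cpde (nZ v) (nZ v') * Lp_norm p (lebesgue_on D) (\<lambda>x. \<D> v x - \<D> v' x)"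
    \<comment> \<open>neural networks\<close>
    and "1 \<le> K" and "n 0 = CARD('d)" and "n K = CARD('m)"
    and "\<Theta> \<subseteq> param_space K n"
    and "\<And>\<theta>. \<theta> \<in> \<Theta> \<Longrightarrow> neural_net K n sg \<theta> \<in> Xs \<and> nXs (neural_net K n sg \<theta>) < \<infinity>"
    \<comment> \<open>quadrature points and weights, PINN algorithm\<close>
    and "1 \<le> N" and "\<And>i. i \<in> {1..N} \<Longrightarrow> y i \<in> D" and "\<And>i. i \<in> {1..N} \<Longrightarrow> 0 < w i"
    and "0 \<le> lam"
    and "approx_local_minimizer
           (\<lambda>\<theta>. quadrature N y w (\<lambda>z. norm (residual \<D> f (neural_net K n sg \<theta>) z) powr p)
                  + lam * Jreg \<theta>) \<Theta> \<theta>s"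
    and "ustar = neural_net K n sg \<theta>s" and "ustar \<in> Z"
    \<comment> \<open>quadrature error for the residual\<close>
    and "residual \<D> f ustar \<in> Zs"
    and "0 < \<alpha>"
    and "\<bar>(LINT z|lebesgue_on D. norm (residual \<D> f ustar z) powr p)
            - quadrature N y w (\<lambda>z. norm (residual \<D> f ustar z) powr p)\<bar>
           \<le> Cquad (nZs1 (\<lambda>z. norm (residual \<D> f ustar z) powr p)) CARD('d) * real N powr (- \<alpha>)"
  shows "sobolev_norm D s q (\<lambda>x. u x - ustar x)
           \<le> Cpde (nZ u) (nZ ustar)
               * (quadrature N y w (\<lambda>z. norm (residual \<D> f ustar z) powr p)) powr (1 / p)
             + Cpde (nZ u) (nZ ustar)
               * Cquad (nZs1 (\<lambda>z. norm (residual \<D> f ustar z) powr p)) CARD('d) powr (1 / p)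
               * real N powr (- (\<alpha> / p))"
proof -
  let ?M = "lebesgue_on D"
  let ?C = "Cpde (nZ u) (nZ ustar)"
  let ?Q = "quadrature N y w (\<lambda>z. norm (residual \<D> f ustar z) powr p)"
  let ?Cq = "Cquad (nZs1 (\<lambda>z. norm (residual \<D> f ustar z) powr p)) CARD('d)"
  \<comment> \<open>Exchanging integrands that agree only almost everywhere requires both to be
    measurable, which membership in an Lp space supplies.\<close>
  have Ys_meas: "g \<in> borel_measurable ?M" if "g \<in> Ys" for g
    using closed_subspace_of_subset[OF assms(7)] that by (auto simp: Lp_space_def)
  have Z_meas: "\<D> v \<in> borel_measurable ?M" if "v \<in> Z" for v
    using closed_subspace_of_subset[OF \<open>closed_subspace_of Z Xs nXs\<close>] assms(16) that
    by (intro Ys_meas) auto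
  have "Lp_norm p ?M (\<lambda>x. \<D> u x - \<D> ustar x) = Lp_norm p ?M (residual \<D> f ustar)"
  proof (rule Lp_norm_cong_AE)
    show "(\<lambda>x. \<D> u x - \<D> ustar x) \<in> borel_measurable ?M"
      using Z_meas \<open>u \<in> Z\<close> \<open>ustar \<in> Z\<close> by (intro borel_measurable_diff)
    show "residual \<D> f ustar \<in> borel_measurable ?M"
      using Ys_meas \<open>residual \<D> f ustar \<in> Zs\<close> \<open>Zs \<subseteq> Ys\<close> by blast
    \<comment> \<open>Where \<open>\<D> u x = f x\<close>, the difference is minus the residual, so
      only the norms coincide.\<close>
    show "AE x in ?M. norm (\<D> u x - \<D> ustar x) = norm (residual \<D> f ustar x)"
      using \<open>AE x in ?M. \<D> u x = f x\<close> by eventually_elim (simp add: residual_def norm_minus_commute)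
  qed
  then have "sobolev_norm D s q (\<lambda>x. u x - ustar x) \<le> ?C * Lp_norm p ?M (residual \<D> f ustar)"
    \<comment> \<open>This is the stability estimate, applied to the exact solution and the
      network.\<close>
    using assms(25)[OF \<open>u \<in> Z\<close> \<open>ustar \<in> Z\<close>] by simp
  also have "\<dots> \<le> ?C * (?Q powr (1 / p) + ?Cq powr (1 / p) * real N powr (- (\<alpha> / p)))"
  proof (rule mult_left_mono)
    have "0 \<le> ?Q"
      using assms(33) by (intro quadrature_nonneg) (auto intro: less_imp_le)
    then show "Lp_norm p ?M (residual \<D> f ustar)
        \<le> ?Q powr (1 / p) + ?Cq powr (1 / p) * real N powr (- (\<alpha> / p))"
      using \<open>1 \<le> p\<close> \<open>1 \<le> N\<close> assms(40) by (intro Lp_norm_le_quadrature)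
    \<comment> \<open>Nonnegativity of \<open>Cpde\<close> is available at nonnegative arguments,
      and \<open>nZ\<close> takes such values on \<open>Z\<close>.\<close>
    show "0 \<le> ?C"
      using \<open>norm_on ?M Z nZ\<close> \<open>u \<in> Z\<close> \<open>ustar \<in> Z\<close> by (intro assms(24)) (auto simp: norm_on_def)
  qed
  finally show ?thesis
    by (simp add: algebra_simps)
qed

end
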